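(* Let $\Phi:\mathbb{M}_n\to\mathbb{M}_{n'}$ be a positive linear map. Let $A\in\mathbb{M}_n^+$ be given as $A=\sum_{i=1}^n a_i|v_i\rangle\langle v_i|$ with $a_1\ge\dots\ge a_n$ and an orthonormal basis $\{v_1,\dots,v_n\}$ of $\mathbb{C}^n$. Then $\lim_{p\to\infty}\Phi(A^p)^{1/p}$ exists and $$\lim_{p\to\infty}\Phi(A^p)^{1/p}=\sum_{i=1}^n a_iP_{\mathcal{M}_i},$$ where $$\mathcal{M}_1:=\mathrm{ran}\,\Phi(|v_1\rangle\langle v_1|),\qquad \mathcal{M}_i:=\bigvee_{j=1}^{i}\mathrm{ran}\,\Phi(|v_j\rangle\langle v_j|)\ominus\bigvee_{j=1}^{i-1}\mathrm{ran}\,\Phi(|v_j\rangle\langle v_j|),\quad 2\le i\le n,$$ and $P_{\mathcal{M}_i}$ is the orthogonal projection onto $\mathcal{M}_i$ for $1\le i\le n$.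
   Context: $\mathbb{M}_n$ is the algebra of $n\times n$ complex matrices and $\mathbb{M}_n^+$ the set of positive semidefinite matrices in $\mathbb{M}_n$. A linear map $\Phi:\mathbb{M}_n\to\mathbb{M}_{n'}$ is positive if $\Phi(X)\in\mathbb{M}_{n'}^+$ for all $X\in\mathbb{M}_n^+$. $|u\rangle\langle v|$ denotes the rank-one operator $x\mapsto\langle v,x\rangle u$. $\mathrm{ran}\,X$ is the range of $X$; $\bigvee_j\mathcal{R}_j$ is the linear span (sum) of the subspaces $\mathcal{R}_j$; for subspaces $\mathcal{S}\subset\mathcal{R}$, $\mathcal{R}\ominus\mathcal{S}$ is the orthogonal complement of $\mathcal{S}$ in $\mathcal{R}$. Powers of positive semidefinite matrices are defined by functional calculus (with $0^p=0$ for $p>0$). The limit is over real $p\to\infty$. *)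

theory Defs
  imports "HOL-Analysis.Analysis"
begin

text \<open>
  The inner product that the library puts on \<^typ>\<open>complex^'n\<close> is the real one (the real part of
  the Hermitian inner product), so the Hermitian inner product is introduced here.  It is
  conjugate linear in the first argument.
\<close>

definition cinner :: "complex^'n \<Rightarrow> complex^'n \<Rightarrow> complex" where
  "cinner x y = (\<Sum>i\<in>UNIV. cnj (x $ i) * (y $ i))"

definition cadjoint :: "complex^'n^'m \<Rightarrow> complex^'m^'n" where
  "cadjoint A = (\<chi> i j. cnj (A $ j $ i))"

definition psd :: "complex^'n^'n \<Rightarrow> bool" where
  "psd A \<longleftrightarrow> cadjoint A = A \<and> (\<forall>x. 0 \<le> Re (cinner x (A *v x)))"

text \<open>Multiplication of a matrix by a scalar; the library's \<open>*s\<close> multiplies a vector by a scalar of its component type.\<close>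

definition mscale :: "complex \<Rightarrow> complex^'n^'m \<Rightarrow> complex^'n^'m"  (infixr "*\<^sub>m" 75) where
  "c *\<^sub>m A = (\<chi> i j. c * A $ i $ j)"

definition ketbra :: "complex^'m \<Rightarrow> complex^'n \<Rightarrow> complex^'n^'m" where
  "ketbra u v = (\<chi> i j. u $ i * cnj (v $ j))"

lemma ketbra_mult_vec: "ketbra u v *v x = cinner v x *s u"
  by (simp add: ketbra_def cinner_def matrix_vector_mult_def vec_eq_iff sum_distrib_left mult_ac)

lemma vector_space_mscale: "vector_space (mscale :: complex \<Rightarrow> complex^'n^'m \<Rightarrow> _)"
  by unfold_locales (simp_all add: mscale_def vec_eq_iff algebra_simps)

definition positive_linear_map :: "(complex^'n^'n \<Rightarrow> complex^'m^'m) \<Rightarrow> bool" where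
  "positive_linear_map \<Phi> \<longleftrightarrow>
     Vector_Spaces.linear (*\<^sub>m) (*\<^sub>m) \<Phi> \<and> (\<forall>X. psd X \<longrightarrow> psd (\<Phi> X))"

definition mat_range :: "complex^'n^'m \<Rightarrow> (complex^'m) set" where
  "mat_range X = range (\<lambda>x. X *v x)"

definition ominus :: "(complex^'n) set \<Rightarrow> (complex^'n) set \<Rightarrow> (complex^'n) set"  (infixl "\<ominus>" 65) where
  "R \<ominus> S = {x \<in> R. \<forall>y\<in>S. cinner y x = 0}"

text \<open>The matrix of the orthogonal projection onto a complex linear subspace \<open>S\<close>.\<close>

definition orth_proj :: "(complex^'n) set \<Rightarrow> complex^'n^'n" where
  "orth_proj S = (THE P. \<forall>x. P *v x \<in> S \<and> (\<forall>y\<in>S. cinner y (x - P *v x) = 0))"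

text \<open>
  Functional calculus \<open>f(A) = \<Sum>\<^sub>t f(t) P\<^sub>t\<close> of a Hermitian matrix \<open>A\<close>, where \<open>t\<close> runs over the
  (necessarily real, finitely many) eigenvalues of \<open>A\<close> and \<open>P\<^sub>t\<close> is the orthogonal projection
  onto the eigenspace of \<open>t\<close>.
\<close>

definition eigenspace :: "complex^'n^'n \<Rightarrow> real \<Rightarrow> (complex^'n) set" where
  "eigenspace A t = {x. A *v x = complex_of_real t *s x}"

definition real_eigenvalues :: "complex^'n^'n \<Rightarrow> real set" where
  "real_eigenvalues A = {t. \<exists>x. x \<noteq> 0 \<and> A *v x = complex_of_real t *s x}"

definition fun_calc :: "(real \<Rightarrow> real) \<Rightarrow> complex^'n^'n \<Rightarrow> complex^'n^'n" where
  "fun_calc f A = (\<Sum>t\<in>real_eigenvalues A. complex_of_real (f t) *\<^sub>m orth_proj (eigenspace A t))"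

text \<open>Since \<open>0 powr p = 0\<close>, this follows the convention \<open>0\<^sup>p = 0\<close>.\<close>

definition mpowr :: "complex^'n^'n \<Rightarrow> real \<Rightarrow> complex^'n^'n" where
  "mpowr A p = fun_calc (\<lambda>t. t powr p) A"

definition orthonormal_basis :: "nat \<Rightarrow> (nat \<Rightarrow> complex^'n) \<Rightarrow> bool" where
  "orthonormal_basis n v \<longleftrightarrow>
     (\<forall>i\<in>{1..n}. \<forall>j\<in>{1..n}. cinner (v i) (v j) = (if i = j then 1 else 0)) \<and>
     vec.span (v ` {1..n}) = UNIV"

definition ran_join ::
  "(complex^'n^'n \<Rightarrow> complex^'m^'m) \<Rightarrow> (nat \<Rightarrow> complex^'n) \<Rightarrow> nat \<Rightarrow> (complex^'m) set" where
  "ran_join \<Phi> v i = vec.span (\<Union>j\<in>{1..i}. mat_range (\<Phi> (ketbra (v j) (v j))))"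

definition M_space ::
  "(complex^'n^'n \<Rightarrow> complex^'m^'m) \<Rightarrow> (nat \<Rightarrow> complex^'n) \<Rightarrow> nat \<Rightarrow> (complex^'m) set" where
  "M_space \<Phi> v i =
     (if i = 1 then mat_range (\<Phi> (ketbra (v 1) (v 1))) else ran_join \<Phi> v i \<ominus> ran_join \<Phi> v (i - 1))"

end

theory Submission
  imports Defs
begin

text \<open>
  Put \<open>B\<^sub>j = \<Phi>(|v\<^sub>j\<rangle>\<langle>v\<^sub>j|)\<close>.  By linearity \<open>\<Phi>(A\<^sup>p)\<close> is the weighted sum of the \<open>a\<^sub>j\<^sup>p B\<^sub>j\<close>, where the \<open>B\<^sub>j\<close> are
  positive semidefinite and the weights decrease in \<open>j\<close>.  Let \<open>R\<^sub>i\<close> be the span of the ranges of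
  \<open>B\<^sub>1, \<dots>, B\<^sub>i\<close> and let \<open>D\<close> be the claimed limit, which is \<open>a\<^sub>i\<close> on the layer \<open>M\<^sub>i = R\<^sub>i \<ominus> R\<^sub>i\<^sub>-\<^sub>1\<close>.  Up to
  constants that do not depend on \<open>p\<close>, the sum is comparable with \<open>D\<^sup>p\<close>: on \<open>M\<^sub>i\<close> the matrices
  \<open>B\<^sub>1, \<dots>, B\<^sub>i\<^sub>-\<^sub>1\<close> vanish, which bounds the sum from above by a multiple of \<open>a\<^sub>i\<^sup>p\<close>, and the ranges of
  \<open>B\<^sub>1, \<dots>, B\<^sub>i\<close>, all with weight at least \<open>a\<^sub>i\<^sup>p\<close>, span \<open>R\<^sub>i\<close>, which bounds it from below.  The \<open>p\<close>-th root
  turns the constants into factors that tend to 1.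

  Taking roots in such operator inequalities would require the operator monotonicity of
  \<open>t \<mapsto> t\<^bsup>1/p\<^esup>\<close>.  The proof avoids it by comparing eigenvectors.  Fix a vector \<open>x\<close> in \<open>M\<^sub>i\<close> and let \<open>u\<close> be its
  component in the eigenspace of the weighted sum for the eigenvalue \<open>s\<close>.  The two bounds say that \<open>s\<close>
  and \<open>a\<^sub>i\<^sup>p\<close> agree up to a factor of order \<open>1 / \<parallel>u\<parallel>\<^sup>2\<close>.  Hence \<open>s\<^bsup>1/p\<^esup>\<close> is close to \<open>a\<^sub>i\<close> unless \<open>u\<close> is
  tiny, and in either case \<open>(s\<^bsup>1/p\<^esup> - a\<^sub>i) u\<close> has norm \<open>O(1/p)\<close> (\<open>powr_ratio_gap\<close>).  The number of
  eigenvalues is bounded by the dimension, so summing over them shows that the root applied to \<open>x\<close>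
  differs from \<open>a\<^sub>i x\<close> by \<open>O(1/p)\<close> (\<open>mpowr_near_scalar\<close>).  The layers together with the complement of
  the last span exhaust the space, so convergence on them is convergence of matrices
  (\<open>mpowr_weighted_sum_tendsto\<close>).  The spectral theorem behind the decomposition of \<open>x\<close> is
  \<open>hermitian_spectral_resolution\<close>.
\<close>

section \<open>The Hermitian inner product\<close>

lemma cinner_add_left: "cinner (x + y) z = cinner x z + cinner y z"
  and cinner_add_right: "cinner z (x + y) = cinner z x + cinner z y"
  and cinner_diff_left: "cinner (x - y) z = cinner x z - cinner y z"
  and cinner_diff_right: "cinner z (x - y) = cinner z x - cinner z y"
  and cinner_scale_left: "cinner (c *s x) z = cnj c * cinner x z"
  and cinner_scale_right: "cinner z (c *s x) = c * cinner z x"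
  by (simp_all add: cinner_def algebra_simps sum.distrib sum_subtractf sum_distrib_left)

lemma cinner_zero [simp]: "cinner 0 x = 0" "cinner x 0 = 0"
  by (simp_all add: cinner_def)

lemmas cinner_simps = cinner_add_left cinner_add_right cinner_diff_left cinner_diff_right
  cinner_scale_left cinner_scale_right

lemma cinner_commute: "cinner y x = cnj (cinner x y)"
  by (simp add: cinner_def mult.commute)

lemma cinner_eq_0_commute: "cinner x y = 0 \<longleftrightarrow> cinner y x = 0"
  by (metis cinner_commute complex_cnj_zero)

lemma Re_cinner: "Re (cinner x y) = inner x y"
  by (simp add: cinner_def inner_vec_def inner_complex_def)

lemma cinner_self: "cinner x x = complex_of_real ((norm x)\<^sup>2)"
proof -
  have "Im (cinner x x) = 0"
    using cinner_commute[of x x] by (metis complex_cnj_cancel_iff complex_is_Real_iff Reals_cnj_iff)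
  then show ?thesis
    by (simp add: complex_eq_iff Re_cinner power2_norm_eq_inner)
qed

lemma cinner_self_eq_0_iff [simp]: "cinner x x = 0 \<longleftrightarrow> x = 0"
  by (simp add: cinner_self)

lemma cinner_cadjoint: "cinner (A *v x) y = cinner x (cadjoint A *v y)"
proof -
  have "cinner (A *v x) y = (\<Sum>i\<in>UNIV. \<Sum>j\<in>UNIV. cnj (A $ i $ j) * cnj (x $ j) * y $ i)"
    by (simp add: cinner_def matrix_vector_mult_def sum_distrib_right)
  also have "\<dots> = (\<Sum>j\<in>UNIV. \<Sum>i\<in>UNIV. cnj (A $ i $ j) * cnj (x $ j) * y $ i)"
    by (rule sum.swap)
  also have "\<dots> = cinner x (cadjoint A *v y)"
    by (simp add: cinner_def cadjoint_def matrix_vector_mult_def sum_distrib_left mult_ac)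
  finally show ?thesis .
qed

lemma hermitian_cinner:
  assumes "cadjoint A = A"
  shows "cinner (A *v x) y = cinner x (A *v y)"
  using cinner_cadjoint[of A x y] assms by simp

lemma psd_hermitian: "psd A \<Longrightarrow> cadjoint A = A"
  by (simp add: psd_def)

lemma psd_nonneg: "psd A \<Longrightarrow> 0 \<le> Re (cinner x (A *v x))"
  by (simp add: psd_def)

lemma psd_ketbra: "psd (ketbra v v)"
proof -
  have "cinner x (ketbra v v *v x) = complex_of_real ((cmod (cinner v x))\<^sup>2)" for x
    by (simp add: ketbra_mult_vec cinner_scale_right cinner_commute[of x v] complex_norm_square
        del: of_real_power)
  then have "0 \<le> Re (cinner x (ketbra v v *v x))" for x
    by simp
  moreover have "cadjoint (ketbra v v) = ketbra v v"
    by (simp add: cadjoint_def ketbra_def vec_eq_iff mult.commute)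
  ultimately show ?thesis
    by (simp add: psd_def)
qed

section \<open>Orthogonal projections onto complex subspaces\<close>

lemma scaleR_eq_scale: "r *\<^sub>R x = complex_of_real r *s (x :: complex^'n)"
  by (simp add: vec_eq_iff scaleR_conv_of_real[symmetric])

lemma vec_subspace_imp_subspace:
  fixes S :: "(complex^'n) set"
  shows "vec.subspace S \<Longrightarrow> subspace S"
  by (simp add: vec.subspace_def subspace_def scaleR_eq_scale)

text \<open>
  The library's orthogonality uses only the real part of \<open>cinner\<close>.  A complex subspace contains
  \<open>\<i> y\<close> along with \<open>y\<close>, and testing against \<open>\<i> y\<close> controls the imaginary part.
\<close>
lemma cinner_eq_0_of_inner_eq_0:
  fixes S :: "(complex^'n) set"
  assumes "vec.subspace S" "\<And>y. y \<in> S \<Longrightarrow> inner y z = 0" "y \<in> S"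
  shows "cinner y z = 0"
proof -
  have "\<i> *s y \<in> S"
    using assms by (simp add: vec.subspace_scale)
  with assms have "Re (cinner (\<i> *s y) z) = 0" "Re (cinner y z) = 0"
    by (simp_all add: Re_cinner)
  then show ?thesis
    by (simp add: cinner_simps complex_eq_iff)
qed

lemma orthogonal_decomposition:
  fixes S :: "(complex^'n) set"
  assumes "vec.subspace S"
  shows "\<exists>y z. x = y + z \<and> y \<in> S \<and> (\<forall>w\<in>S. cinner w z = 0)"
proof -
  have sp: "span S = S"
    using assms by (simp add: vec_subspace_imp_subspace)
  obtain y z where yz: "y \<in> span S" "\<And>w. w \<in> span S \<Longrightarrow> orthogonal z w" "x = y + z"
    using orthogonal_subspace_decomp_exists[of S x] by metis
  have "cinner w z = 0" if "w \<in> S" for w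
    using cinner_eq_0_of_inner_eq_0[OF assms _ that, of z] yz sp
    by (simp add: orthogonal_def inner_commute)
  with yz sp show ?thesis by blast
qed

lemma orthogonal_decomposition_unique:
  fixes S :: "(complex^'n) set"
  assumes S: "vec.subspace S" and y: "y \<in> S" "\<And>w. w \<in> S \<Longrightarrow> cinner w (x - y) = 0"
    and y': "y' \<in> S" "\<And>w. w \<in> S \<Longrightarrow> cinner w (x - y') = 0"
  shows "y = y'"
proof -
  have d: "y - y' \<in> S"
    using assms by (simp add: vec.subspace_diff)
  have "cinner (y - y') (y - y') = cinner (y - y') (x - y') - cinner (y - y') (x - y)"
    by (simp add: cinner_simps)
  also have "\<dots> = 0"
    using d y y' by simp
  finally show ?thesis by simp
qed

text \<open>
  Existence and uniqueness of the orthogonal decomposition make the choice of the component in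
  \<open>S\<close> additive and homogeneous, so it is given by a matrix; this justifies the description operator
  in the definition of \<open>orth_proj\<close>.
\<close>
lemma orth_proj_characterization:
  fixes S :: "(complex^'n) set"
  assumes S: "vec.subspace S"
  shows "\<forall>x. orth_proj S *v x \<in> S \<and> (\<forall>y\<in>S. cinner y (x - orth_proj S *v x) = 0)"
proof -
  define good where "good x y \<longleftrightarrow> y \<in> S \<and> (\<forall>w\<in>S. cinner w (x - y) = 0)" for x y
  have uniq: "good x y \<Longrightarrow> good x y' \<Longrightarrow> y = y'" for x y y'
    using orthogonal_decomposition_unique[OF S] unfolding good_def by blast
  have "\<exists>y. good x y" for x
    using orthogonal_decomposition[OF S, of x] by (auto simp: good_def)
  then obtain f where f: "\<And>x. good x (f x)" by metis
  have "good (x + y) (f x + f y)" for x y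
    using f[of x] f[of y] S by (simp add: good_def cinner_simps vec.subspace_add)
  moreover have "good (c *s x) (c *s f x)" for c x
    using f[of x] S
    by (simp add: good_def cinner_simps vec.subspace_scale flip: right_diff_distrib)
  ultimately have "Vector_Spaces.linear (*s) (*s) f"
    by (intro Vector_Spaces.linear_iff[THEN iffD2] conjI allI vec.vector_space_axioms)
      (use f uniq in blast)+
  then have "matrix f *v x = f x" for x
    by (simp add: matrix_works)
  then have ex: "\<forall>x. good x (matrix f *v x)"
    using f by simp
  show ?thesis
    unfolding orth_proj_def good_def[symmetric]
  proof (rule theI)
    show "\<forall>x. good x (matrix f *v x)" by (fact ex)
    show "P = matrix f" if "\<forall>x. good x (P *v x)" for P
      unfolding matrix_eq using that ex uniq by blast
  qed
qed

lemma orth_proj_in: "vec.subspace S \<Longrightarrow> orth_proj S *v x \<in> S"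
  using orth_proj_characterization by blast

lemma cinner_orth_proj_residual:
  "vec.subspace S \<Longrightarrow> y \<in> S \<Longrightarrow> cinner y (x - orth_proj S *v x) = 0"
  using orth_proj_characterization by blast

lemma orth_proj_unique:
  assumes "vec.subspace S" "y \<in> S" "\<And>w. w \<in> S \<Longrightarrow> cinner w (x - y) = 0"
  shows "orth_proj S *v x = y"
  using assms orthogonal_decomposition_unique orth_proj_in cinner_orth_proj_residual by blast

lemma orth_proj_fixes: "vec.subspace S \<Longrightarrow> x \<in> S \<Longrightarrow> orth_proj S *v x = x"
  by (rule orth_proj_unique) auto

lemma orth_proj_kills:
  "vec.subspace S \<Longrightarrow> (\<And>w. w \<in> S \<Longrightarrow> cinner w x = 0) \<Longrightarrow> orth_proj S *v x = 0"
  by (rule orth_proj_unique) (auto simp: vec.subspace_0)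

lemma cinner_orth_proj_self:
  assumes "vec.subspace S"
  shows "cinner (orth_proj S *v x) x = complex_of_real ((norm (orth_proj S *v x))\<^sup>2)"
  using cinner_orth_proj_residual[OF assms orth_proj_in[OF assms], of x x]
  by (simp add: cinner_simps cinner_self)

section \<open>Spectral resolution of a Hermitian matrix\<close>

lemma subspace_eigenspace: "vec.subspace (eigenspace A t)"
  by (simp add: vec.subspace_def eigenspace_def matrix_vector_right_distrib
      vector_scalar_commute vector_add_ldistrib vector_smult_assoc mult.commute)

lemma eigenspace_orthogonal:
  assumes A: "cadjoint A = A" and "x \<in> eigenspace A s" "y \<in> eigenspace A t" "s \<noteq> t"
  shows "cinner x y = 0"
proof -
  have "complex_of_real s * cinner x y = cinner (A *v x) y"
    using assms by (simp add: eigenspace_def cinner_simps)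
  also have "\<dots> = complex_of_real t * cinner x y"
    using \<open>y \<in> eigenspace A t\<close> by (simp add: hermitian_cinner[OF A] eigenspace_def cinner_simps)
  finally show ?thesis using \<open>s \<noteq> t\<close> by simp
qed

text \<open>
  Eigenvectors for different eigenvalues are orthogonal, so there cannot be more eigenvalues than
  the (real) dimension of the space.  The cruder real count is enough: any bound that depends only
  on the type is uniform in \<open>A\<close>.
\<close>
lemma real_eigenvalues_finite_card:
  fixes A :: "complex^'n^'n"
  assumes A: "cadjoint A = A"
  shows "finite (real_eigenvalues A)" "card (real_eigenvalues A) \<le> DIM(complex^'n)"
proof -
  let ?E = "real_eigenvalues A"
  obtain e where e: "\<And>t. t \<in> ?E \<Longrightarrow> e t \<noteq> 0 \<and> e t \<in> eigenspace A t"
  proof -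
    have "\<forall>t\<in>?E. \<exists>x. x \<noteq> 0 \<and> x \<in> eigenspace A t"
      by (auto simp: real_eigenvalues_def eigenspace_def)
    from bchoice[OF this] that show thesis by blast
  qed
  have orth: "inner (e s) (e t) = 0" if "s \<in> ?E" "t \<in> ?E" "s \<noteq> t" for s t
    using eigenspace_orthogonal[OF A] e that by (metis Re_cinner zero_complex.simps(1))
  have inj: "inj_on e ?E"
    by (rule inj_onI) (metis orth e inner_eq_zero_iff)
  have "independent (e ` ?E)"
    by (rule pairwise_orthogonal_independent)
      (use e orth in \<open>auto simp: pairwise_def orthogonal_def\<close>)
  then have "finite (e ` ?E)" "card (e ` ?E) \<le> DIM(complex^'n)"
    using independent_bound[of "e ` ?E"] by auto
  with inj show "finite ?E" "card ?E \<le> DIM(complex^'n)"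
    by (auto simp: finite_image_iff card_image)
qed

text \<open>
  A maximizer \<open>x\<close> of the Rayleigh quotient on the unit sphere of \<open>W\<close> is an eigenvector: the residual
  \<open>z = A x - t x\<close> lies in \<open>W\<close>, and if it did not vanish, then moving from \<open>x\<close> in direction \<open>z\<close> would
  raise the quotient to first order.
\<close>
lemma hermitian_eigenvector_in_invariant_subspace:
  fixes A :: "complex^'n^'n"
  assumes A: "cadjoint A = A" and W: "vec.subspace W" and inv: "\<And>x. x \<in> W \<Longrightarrow> A *v x \<in> W"
    and nz: "x0 \<in> W" "x0 \<noteq> 0"
  obtains x t where "x \<in> W" "x \<noteq> 0" "A *v x = complex_of_real t *s x"
proof -
  have subW: "subspace W"
    using W by (rule vec_subspace_imp_subspace)
  let ?q = "\<lambda>x. inner x (A *v x)"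
  have lin: "bounded_linear ((*v) A)"
    by (simp add: linear_conv_bounded_linear[symmetric])
  have "compact (sphere 0 1 \<inter> W)"
    by (intro compact_Int_closed compact_sphere closed_subspace subW)
  moreover have "(1 / norm x0) *\<^sub>R x0 \<in> sphere 0 1 \<inter> W"
    using nz subW by (simp add: subspace_scale)
  then have "sphere 0 1 \<inter> W \<noteq> {}" by blast
  moreover have "continuous_on (sphere 0 1 \<inter> W) ?q"
    by (intro continuous_intros bounded_linear.continuous_on[OF lin])
  ultimately obtain x where x: "x \<in> W" "norm x = 1"
    and max: "\<And>y. y \<in> W \<Longrightarrow> norm y = 1 \<Longrightarrow> ?q y \<le> ?q x"
    using continuous_attains_sup[of "sphere 0 1 \<inter> W" ?q] by (metis (no_types, lifting) IntD1 IntD2 IntI mem_sphere_0)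
  define t where "t = ?q x"
  have sa: "inner (A *v y) z = inner y (A *v z)" for y z
    using hermitian_cinner[OF A, of y z] by (metis Re_cinner)
  have q_le: "?q y \<le> t * (norm y)\<^sup>2" if "y \<in> W" for y
  proof (cases "y = 0")
    case False
    have "?q ((1 / norm y) *\<^sub>R y) \<le> t"
      unfolding t_def using that False subW by (intro max) (auto simp: subspace_scale)
    moreover have "?q ((1 / norm y) *\<^sub>R y) = ?q y / (norm y)\<^sup>2"
      by (simp add: linear_cmul[OF bounded_linear.linear[OF lin]] power2_eq_square)
    ultimately have "?q y / (norm y)\<^sup>2 \<le> t" by simp
    then show ?thesis
      using False by (simp add: pos_divide_le_eq)
  qed simp
  define z where "z = A *v x - t *\<^sub>R x"
  have zW: "z \<in> W"
    using inv x subW by (simp add: z_def subspace_diff subspace_scale)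
  have "(norm z)\<^sup>2 = 0"
  proof (rule ccontr)
    assume ne: "(norm z)\<^sup>2 \<noteq> 0"
    \<comment> \<open>\<open>K\<close> dominates the second order term, so the step \<open>h\<close> below is short enough to see the first order gain.\<close>
    define K where "K = \<bar>t * (norm z)\<^sup>2 - ?q z\<bar> + 1"
    define h where "h = (norm z)\<^sup>2 / K"
    have K: "K > 0" unfolding K_def by linarith
    have "(norm z)\<^sup>2 = inner (A *v x - t *\<^sub>R x) z"
      by (simp add: power2_norm_eq_inner z_def)
    then have zz: "inner x (A *v z) - t * inner x z = (norm z)\<^sup>2"
      by (simp add: sa inner_diff_left)
    have "x + h *\<^sub>R z \<in> W"
      using x zW subW by (simp add: subspace_add subspace_scale)
    from q_le[OF this]
    have "?q x + 2 * h * inner x (A *v z) + h\<^sup>2 * ?q z \<le>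
        t * ((norm x)\<^sup>2 + 2 * h * inner x z + h\<^sup>2 * (norm z)\<^sup>2)"
      using sa[of x z] unfolding power2_norm_eq_inner
      by (simp add: matrix_vector_right_distrib linear_cmul[OF bounded_linear.linear[OF lin]]
          inner_add_left inner_add_right inner_commute[of z x] inner_commute[of z "A *v x"]
          power2_eq_square algebra_simps)
    then have "2 * h * (inner x (A *v z) - t * inner x z) \<le> h\<^sup>2 * (t * (norm z)\<^sup>2 - ?q z)"
      using x by (simp add: t_def algebra_simps)
    also have "\<dots> \<le> h\<^sup>2 * K"
      unfolding K_def by (intro mult_left_mono) auto
    finally have "2 * h * (norm z)\<^sup>2 \<le> h\<^sup>2 * K"
      using zz by simp
    moreover have "h > 0" using ne K by (simp add: h_def)
    ultimately have "2 * (norm z)\<^sup>2 \<le> h * K"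
      by (simp add: power2_eq_square)
    also have "h * K = (norm z)\<^sup>2" using K by (simp add: h_def)
    finally show False using ne by simp
  qed
  then have "A *v x = complex_of_real t *s x"
    by (simp add: z_def scaleR_eq_scale)
  moreover have "x \<noteq> 0" using x by auto
  ultimately show thesis using x that by blast
qed

text \<open>
  The orthogonal complement \<open>W\<close> of all eigenspaces is invariant.  If it were nonzero it would contain
  an eigenvector, which would be orthogonal to itself.
\<close>
lemma hermitian_spectral_resolution:
  fixes A :: "complex^'n^'n"
  assumes A: "cadjoint A = A"
  shows "(\<Sum>t\<in>real_eigenvalues A. orth_proj (eigenspace A t) *v x) = x"
proof -
  let ?E = "real_eigenvalues A"
  let ?P = "\<lambda>t. orth_proj (eigenspace A t)"
  define W where "W = {y. \<forall>t. \<forall>w\<in>eigenspace A t. cinner w y = 0}"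
  have W: "vec.subspace W"
    by (simp add: W_def vec.subspace_def cinner_simps)
  have inv: "A *v y \<in> W" if "y \<in> W" for y
    unfolding W_def
  proof (intro CollectI allI ballI)
    fix t w assume w: "w \<in> eigenspace A t"
    have "cinner w (A *v y) = complex_of_real t * cinner w y"
      using w by (simp add: hermitian_cinner[OF A, symmetric] eigenspace_def cinner_simps)
    then show "cinner w (A *v y) = 0"
      using that w by (auto simp: W_def)
  qed
  have W0: "y = 0" if yW: "y \<in> W" for y
  proof (rule ccontr)
    assume "y \<noteq> 0"
    then obtain z t where z: "z \<in> W" "z \<noteq> 0" "A *v z = complex_of_real t *s z"
      using hermitian_eigenvector_in_invariant_subspace[OF A W inv yW \<open>y \<noteq> 0\<close>] by metis
    then have "cinner z z = 0"
      unfolding W_def eigenspace_def by blast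
    with z show False by simp
  qed
  have "cinner w (x - (\<Sum>t\<in>?E. ?P t *v x)) = 0" if w: "w \<in> eigenspace A s" for w s
  proof (cases "w = 0")
    case False
    then have s: "s \<in> ?E"
      using w by (auto simp: real_eigenvalues_def eigenspace_def)
    have "cinner w (\<Sum>t\<in>?E - {s}. ?P t *v x) = (\<Sum>t\<in>?E - {s}. cinner w (?P t *v x))"
      using real_eigenvalues_finite_card(1)[OF A]
      by (induction rule: infinite_finite_induct) (auto simp: cinner_simps)
    also have "\<dots> = 0"
      using eigenspace_orthogonal[OF A w] orth_proj_in[OF subspace_eigenspace]
      by (intro sum.neutral) blast
    finally have "cinner w (\<Sum>t\<in>?E - {s}. ?P t *v x) = 0" .
    moreover have "cinner w (x - ?P s *v x) = 0"
      using w by (rule cinner_orth_proj_residual[OF subspace_eigenspace])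
    ultimately show ?thesis
      using sum.remove[OF real_eigenvalues_finite_card(1)[OF A] s, of "\<lambda>t. ?P t *v x"]
      by (simp add: cinner_simps)
  qed simp
  then have "x - (\<Sum>t\<in>?E. ?P t *v x) \<in> W"
    by (auto simp: W_def)
  then show ?thesis
    using W0 by fastforce
qed

section \<open>Functional calculus on eigenvectors\<close>

lemma mscale_mult_vec: "(c *\<^sub>m A) *v x = c *s (A *v x)"
  by (simp add: mscale_def matrix_vector_mult_def vec_eq_iff sum_distrib_left mult_ac)

lemma sum_mscale_mult_vec:
  "(\<Sum>i\<in>I. c i *\<^sub>m M i) *v x = (\<Sum>i\<in>I. c i *s (M i *v x))"
  by (induction I rule: infinite_finite_induct)
    (simp_all add: matrix_vector_mult_add_rdistrib mscale_mult_vec)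

lemma fun_calc_mult_vec:
  "fun_calc f A *v x =
    (\<Sum>t\<in>real_eigenvalues A. complex_of_real (f t) *s (orth_proj (eigenspace A t) *v x))"
  by (simp add: fun_calc_def sum_mscale_mult_vec)

text \<open>
  This identifies \<open>fun_calc f A\<close> from any orthonormal eigenbasis, even one whose eigenvalues repeat
  and whose vectors are not grouped into eigenspaces.
\<close>
lemma fun_calc_eigenvector:
  fixes A :: "complex^'n^'n"
  assumes A: "cadjoint A = A" and x: "A *v x = complex_of_real t *s x"
  shows "fun_calc f A *v x = complex_of_real (f t) *s x"
proof (cases "x = 0")
  case False
  have xt: "x \<in> eigenspace A t" using x by (simp add: eigenspace_def)
  have t: "t \<in> real_eigenvalues A" using x False by (auto simp: real_eigenvalues_def)
  have "orth_proj (eigenspace A s) *v x = (if s = t then x else 0)" for s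
    using orth_proj_fixes[OF subspace_eigenspace xt]
      orth_proj_kills[OF subspace_eigenspace eigenspace_orthogonal[OF A _ xt]] by auto
  then have "fun_calc f A *v x =
      (\<Sum>s\<in>real_eigenvalues A. if s = t then complex_of_real (f t) *s x else 0)"
    unfolding fun_calc_mult_vec by (intro sum.cong) auto
  then show ?thesis
    using t real_eigenvalues_finite_card(1)[OF A] by simp
qed simp

section \<open>Positive semidefinite matrices\<close>

lemma cinner_sum_right: "cinner x (\<Sum>i\<in>I. f i) = (\<Sum>i\<in>I. cinner x (f i))"
  by (induction I rule: infinite_finite_induct) (simp_all add: cinner_simps)

lemma psd_0: "psd 0"
  by (simp add: psd_def cadjoint_def vec_eq_iff)

lemma psd_add: "psd A \<Longrightarrow> psd B \<Longrightarrow> psd (A + B)"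
  by (simp add: psd_def cadjoint_def vec_eq_iff matrix_vector_mult_add_rdistrib cinner_simps)

lemma psd_mscale: "0 \<le> r \<Longrightarrow> psd A \<Longrightarrow> psd (complex_of_real r *\<^sub>m A)"
  by (simp add: psd_def mscale_mult_vec cinner_simps)
    (simp add: cadjoint_def mscale_def vec_eq_iff)

lemma psd_sum: "(\<And>i. i \<in> I \<Longrightarrow> psd (f i)) \<Longrightarrow> psd (\<Sum>i\<in>I. f i)"
  by (induction I rule: infinite_finite_induct) (simp_all add: psd_0 psd_add)

lemma psd_eigenvalue_nonneg:
  assumes A: "psd A" and t: "t \<in> real_eigenvalues A"
  shows "0 \<le> t"
proof -
  obtain x where x: "x \<noteq> 0" "A *v x = complex_of_real t *s x"
    using t by (auto simp: real_eigenvalues_def)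
  then have "Re (cinner x (A *v x)) = t * (norm x)\<^sup>2"
    by (simp add: cinner_simps cinner_self del: of_real_power)
  with psd_nonneg[OF A, of x] x show ?thesis
    by (simp add: zero_le_mult_iff)
qed

lemma psd_kernel_of_range_orthogonal:
  assumes "psd B" "\<And>w. w \<in> mat_range B \<Longrightarrow> cinner w x = 0"
  shows "B *v x = 0"
proof -
  have "cinner (B *v x) (B *v x) = cinner (B *v (B *v x)) x"
    using assms(1) by (simp add: hermitian_cinner psd_hermitian)
  also have "\<dots> = 0"
    by (rule assms(2)) (simp add: mat_range_def)
  finally show ?thesis by simp
qed

text \<open>
  The form of \<open>B\<close> is nonnegative at \<open>u + h c\<^sup>* y\<close>, where \<open>c = \<langle>u, B y\<rangle>\<close> and \<open>c\<^sup>*\<close> is its conjugate, which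
  makes the mixed terms real.  Adding 1 to \<open>\<langle>y, B y\<rangle>\<close> weakens the sharp inequality harmlessly and
  lets one choice of \<open>h\<close> serve also when \<open>\<langle>y, B y\<rangle> = 0\<close>.
\<close>
lemma psd_cauchy_schwarz:
  assumes B: "psd B"
  shows "(cmod (cinner u (B *v y)))\<^sup>2 \<le>
    (Re (cinner y (B *v y)) + 1) * Re (cinner u (B *v u))"
proof -
  define c where "c = cinner u (B *v y)"
  define q where "q = Re (cinner y (B *v y))"
  define h where "h = - 1 / (q + 1)"
  have q: "0 \<le> q" unfolding q_def by (rule psd_nonneg[OF B])
  have c': "cinner y (B *v u) = cnj c"
    unfolding c_def by (subst cinner_commute) (simp add: hermitian_cinner psd_hermitian[OF B])
  have cc: "cnj c * c = complex_of_real ((cmod c)\<^sup>2)" "c * cnj c = complex_of_real ((cmod c)\<^sup>2)"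
    by (simp_all only: complex_norm_square mult.commute)
  let ?z = "u + (complex_of_real h * cnj c) *s y"
  have "cinner ?z (B *v ?z) = cinner u (B *v u) + complex_of_real h * (cnj c * c)
      + complex_of_real h * (c * cnj c)
      + complex_of_real h * complex_of_real h * (c * cnj c) * cinner y (B *v y)"
    by (simp add: matrix_vector_right_distrib vector_scalar_commute cinner_simps c'
        flip: c_def) (simp add: algebra_simps)
  then have "Re (cinner ?z (B *v ?z)) =
      Re (cinner u (B *v u)) + 2 * h * (cmod c)\<^sup>2 + h\<^sup>2 * (cmod c)\<^sup>2 * q"
    by (simp add: cc q_def power2_eq_square flip: of_real_mult)
  with psd_nonneg[OF B, of ?z]
  have "0 \<le> Re (cinner u (B *v u)) + 2 * h * (cmod c)\<^sup>2 + h\<^sup>2 * (cmod c)\<^sup>2 * q"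
    by simp
  also have "\<dots> \<le> Re (cinner u (B *v u)) + 2 * h * (cmod c)\<^sup>2 + h\<^sup>2 * (cmod c)\<^sup>2 * (q + 1)"
    by (intro add_left_mono mult_left_mono) auto
  also have "\<dots> = Re (cinner u (B *v u)) - (cmod c)\<^sup>2 / (q + 1)"
    using q by (simp add: h_def power2_eq_square divide_simps)
  finally show ?thesis
    using q unfolding c_def[symmetric] q_def[symmetric] by (simp add: pos_divide_le_eq mult.commute)
qed

section \<open>Roots of a positive semidefinite matrix near a vector\<close>

text \<open>
  The hypothesis only compares \<open>s\<^sup>p\<close> with \<open>t\<^sup>p\<close> up to the factor \<open>r = C / w\<close>, so \<open>s - t \<le> t (r\<^bsup>1/p\<^esup> - 1)\<close>,
  and \<open>r\<^bsup>1/p\<^esup> - 1\<close> is about \<open>ln r / p\<close>.  This is not uniform as \<open>w \<rightarrow> 0\<close>; the weight \<open>sqrt w\<close>,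
  which in the application is the norm of a spectral component, compensates for the growth of
  \<open>ln r\<close>.  The condition \<open>p \<ge> 4\<close> gives \<open>r\<^bsup>1/p\<^esup> \<le> r\<^bsup>1/4\<^esup>\<close>, and together with \<open>ln r \<le> 4 r\<^bsup>1/4\<^esup>\<close> it makes
  the two factors multiply to \<open>4 sqrt r\<close>, which is exactly what \<open>sqrt w\<close> can absorb.
\<close>

lemma powr_ratio_gap:
  fixes s t w C p :: real
  assumes st: "0 \<le> s" "0 \<le> t" and w: "0 < w" "w \<le> C" and p: "4 \<le> p"
    and le: "s powr p * w \<le> C * t powr p"
  shows "(s - t) * sqrt w \<le> 4 * t * sqrt C / p"
proof -
  define r where "r = C / w"
  define y where "y = ln r / p"
  define q where "q = r powr (1 / 4)"
  have r: "1 \<le> r" and r_pos: "0 < r" using w by (auto simp: r_def)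
  have q_pos: "0 < q" using r_pos by (simp add: q_def)
  have y: "0 \<le> y" using r p by (simp add: y_def)
  have root: "r powr (1 / p) = exp y"
    using r_pos by (simp add: powr_def y_def)
  have "s powr p \<le> r * t powr p"
    using le w by (simp add: r_def field_simps)
  then have "(s powr p) powr (1 / p) \<le> (r * t powr p) powr (1 / p)"
    using p by (intro powr_mono2) auto
  then have s_le: "s \<le> exp y * t"
    using st p r_pos by (simp add: powr_powr powr_mult root)
  have "1 - y \<le> exp (- y)"
    using exp_ge_add_one_self[of "- y"] by simp
  then have "exp y * (1 - y) \<le> exp y * exp (- y)"
    by (intro mult_left_mono) auto
  then have "exp y - 1 \<le> y * exp y"
    by (simp add: exp_minus algebra_simps)
  also have "\<dots> \<le> (4 * q / p) * q"
  proof (rule mult_mono)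
    have "ln q \<le> q" using ln_le_minus_one[OF q_pos] by simp
    moreover have "ln r = 4 * ln q" using r_pos by (simp add: q_def ln_powr)
    ultimately show "y \<le> 4 * q / p"
      using p by (simp add: y_def divide_right_mono)
    show "exp y \<le> q"
      unfolding root[symmetric] q_def using r p by (intro powr_mono) (auto simp: field_simps)
  qed (use q_pos p in auto)
  also have "\<dots> = 4 * sqrt r / p"
    using r_pos by (simp add: q_def powr_half_sqrt[symmetric] powr_add[symmetric])
  finally have "exp y - 1 \<le> 4 * sqrt r / p" .
  then have "t * (exp y - 1) \<le> t * (4 * sqrt r / p)"
    using st by (intro mult_left_mono)
  with s_le have "s - t \<le> t * (4 * sqrt r / p)"
    by (simp add: algebra_simps)
  then have "(s - t) * sqrt w \<le> t * (4 * sqrt r / p) * sqrt w"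
    using w by (intro mult_right_mono) auto
  also have "\<dots> = 4 * t * (sqrt r * sqrt w) / p"
    by (simp add: field_simps)
  also have "sqrt r * sqrt w = sqrt C"
    using w by (simp add: r_def flip: real_sqrt_mult)
  finally show ?thesis .
qed

lemma norm_vec_scale: "norm (complex_of_real r *s x) = \<bar>r\<bar> * norm x"
  by (simp add: norm_scaleR flip: scaleR_eq_scale)

text \<open>
  The two hypotheses are a local form of \<open>B \<approx> t\<^sup>p\<close> at the vector \<open>x\<close>.  Decompose \<open>x\<close> into its components
  \<open>u\<close> in the eigenspaces of \<open>B\<close>.  For the eigenvalue \<open>s\<close> and \<open>w = \<parallel>u\<parallel>\<^sup>2\<close>, the upper bound gives
  \<open>s w \<le> C t\<^sup>p\<close>, since the form of \<open>B\<close> at \<open>x\<close> is at least its value at \<open>u\<close>, and the lower bound, tested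
  on \<open>u\<close> itself, gives \<open>t\<^sup>p w \<le> C s\<close>, since \<open>\<langle>u, x\<rangle> = w\<close>.  So either \<open>s\<^bsup>1/p\<^esup>\<close> is close to \<open>t\<close> or the
  component \<open>u\<close> is small, which is what \<open>powr_ratio_gap\<close> quantifies.
\<close>
lemma mpowr_near_scalar:
  fixes B :: "complex^'n^'n"
  assumes B: "psd B" and p: "4 \<le> p" and t: "0 \<le> t" and C: "(norm x)\<^sup>2 \<le> C"
    and upper: "Re (cinner x (B *v x)) \<le> C * t powr p"
    and lower: "\<And>u. t powr p * (cmod (cinner u x))\<^sup>2 \<le> C * Re (cinner u (B *v u))"
  shows "norm (mpowr B (1 / p) *v x - complex_of_real t *s x) \<le>
    DIM(complex^'n) * (4 * t * sqrt C / p)"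
proof -
  have herm: "cadjoint B = B" using B by (rule psd_hermitian)
  let ?E = "real_eigenvalues B"
  let ?u = "\<lambda>s. orth_proj (eigenspace B s) *v x"
  let ?b = "4 * t * sqrt C / p"
  have C0: "0 \<le> C" using C by (rule order_trans[rotated]) simp
  have b0: "0 \<le> ?b" using p t C0 by simp
  have each: "norm (complex_of_real (s powr (1 / p) - t) *s ?u s) \<le> ?b" if s: "s \<in> ?E" for s
  proof (cases "?u s = 0")
    case True
    then show ?thesis using b0 by simp
  next
    case False
    define u where "u = ?u s"
    define w where "w = (norm u)\<^sup>2"
    have s0: "0 \<le> s" using psd_eigenvalue_nonneg[OF B s] .
    have ux: "cinner u x = complex_of_real w"
      unfolding u_def w_def by (rule cinner_orth_proj_self[OF subspace_eigenspace])
    have uu: "cinner u u = complex_of_real w"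
      by (simp add: cinner_self w_def)
    have Bu: "B *v u = complex_of_real s *s u"
      using orth_proj_in[OF subspace_eigenspace, of B s x] by (simp add: u_def eigenspace_def)
    have w_pos: "0 < w" using False by (simp add: w_def u_def)
    have w_le: "w \<le> C"
    proof -
      have "w \<le> norm u * norm x"
        using norm_cauchy_schwarz[of u x] ux by (simp flip: Re_cinner)
      then have "norm u \<le> norm x"
        using False by (simp add: w_def power2_eq_square u_def)
      then have "w \<le> (norm x)\<^sup>2" unfolding w_def by (intro power_mono) auto
      with C show ?thesis by linarith
    qed
    have "cinner x (B *v x) = cinner (x - u) (B *v (x - u)) + complex_of_real (s * w)"
    proof -
      have "cinner (x - u) (B *v u) = 0"
        using ux uu by (simp add: Bu cinner_simps cinner_commute[of x u])
      moreover have "cinner u (B *v (x - u)) = 0"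
        using ux uu by (simp add: hermitian_cinner[OF herm, symmetric] Bu cinner_simps)
      moreover have "cinner u (B *v u) = complex_of_real (s * w)"
        by (simp add: Bu cinner_simps uu)
      ultimately show ?thesis
        by (simp add: cinner_simps matrix_vector_mult_diff_distrib)
    qed
    then have up: "s * w \<le> C * t powr p"
      using psd_nonneg[OF B, of "x - u"] upper by simp
    have "t powr p * w\<^sup>2 \<le> C * (s * w)"
      using lower[of u] by (simp add: ux Bu cinner_simps uu)
    then have low: "t powr p * w \<le> C * s"
      using w_pos by (simp add: power2_eq_square mult.assoc[symmetric])
    have sp: "(s powr (1 / p)) powr p = s"
      using s0 p by (simp add: powr_powr)
    have "(s powr (1 / p) - t) * sqrt w \<le> ?b"
      by (rule powr_ratio_gap) (use t w_pos w_le p up sp in auto)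
    moreover have "(t - s powr (1 / p)) * sqrt w \<le> ?b"
    proof (cases "t \<le> s powr (1 / p)")
      case True
      then have "(t - s powr (1 / p)) * sqrt w \<le> 0"
        using w_pos by (simp add: mult_nonpos_nonneg)
      with b0 show ?thesis by linarith
    next
      case False
      have "(t - s powr (1 / p)) * sqrt w \<le> 4 * s powr (1 / p) * sqrt C / p"
        by (rule powr_ratio_gap) (use t w_pos w_le p low sp in auto)
      also have "\<dots> \<le> ?b"
        using False p C0 by (intro divide_right_mono mult_right_mono) auto
      finally show ?thesis .
    qed
    ultimately have "\<bar>s powr (1 / p) - t\<bar> * sqrt w \<le> ?b"
      by (simp add: abs_if)
    then show ?thesis
      unfolding norm_vec_scale u_def[symmetric] by (simp add: w_def)
  qed
  have "mpowr B (1 / p) *v x - complex_of_real t *s x =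
      (\<Sum>s\<in>?E. complex_of_real (s powr (1 / p)) *s ?u s) - complex_of_real t *s (\<Sum>s\<in>?E. ?u s)"
    by (simp add: mpowr_def fun_calc_mult_vec hermitian_spectral_resolution[OF herm])
  also have "\<dots> = (\<Sum>s\<in>?E. complex_of_real (s powr (1 / p) - t) *s ?u s)"
    by (simp add: vec.scale_sum_right sum_subtractf vec.scale_left_diff_distrib)
  also have "norm \<dots> \<le> (\<Sum>s\<in>?E. ?b)"
    by (rule sum_norm_le) (rule each)
  also have "\<dots> = card ?E * ?b" by simp
  also have "\<dots> \<le> DIM(complex^'n) * ?b"
    using real_eigenvalues_finite_card(2)[OF herm] b0 by (intro mult_right_mono) auto
  finally show ?thesis .
qed

section \<open>Increasing spans of ranges\<close>

definition ranges_span :: "(nat \<Rightarrow> complex^'n^'m) \<Rightarrow> nat \<Rightarrow> (complex^'m) set" where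
  "ranges_span B i = vec.span (\<Union>j\<in>{1..i}. mat_range (B j))"

lemma subspace_ranges_span: "vec.subspace (ranges_span B i)"
  by (simp add: ranges_span_def)

lemma ranges_span_mono: "i \<le> k \<Longrightarrow> ranges_span B i \<subseteq> ranges_span B k"
  unfolding ranges_span_def by (intro vec.span_mono) fastforce

lemma ranges_span_0: "ranges_span B 0 = {0}"
  by (simp add: ranges_span_def)

lemma mat_range_subset_ranges_span: "j \<in> {1..i} \<Longrightarrow> mat_range (B j) \<subseteq> ranges_span B i"
  unfolding ranges_span_def by (rule order_trans[OF UN_upper vec.span_superset])

lemma subspace_ominus:
  assumes "vec.subspace R"
  shows "vec.subspace (R \<ominus> S)"
  using assms by (simp add: ominus_def vec.subspace_def cinner_simps)

text \<open>
  A vector in the span of the ranges is a sum of vectors \<open>B\<^sub>j y\<^sub>j\<close>, to each of which the Cauchy-Schwarz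
  inequality for the form of \<open>B\<^sub>j\<close> applies.  The constant depends on \<open>x\<close> but not on \<open>u\<close>; this
  matters because \<open>u\<close> will be an eigenvector that varies with \<open>p\<close>.
\<close>
lemma ranges_span_functional_bound:
  fixes B :: "nat \<Rightarrow> complex^'m^'m"
  assumes B: "\<And>j. j \<in> {1..i} \<Longrightarrow> psd (B j)" and x: "x \<in> ranges_span B i"
  shows "\<exists>K\<ge>0. \<forall>u. (cmod (cinner u x))\<^sup>2 \<le> K * (\<Sum>j=1..i. Re (cinner u (B j *v u)))"
proof -
  let ?q = "\<lambda>u. \<Sum>j=1..i. Re (cinner u (B j *v u))"
  let ?G = "\<lambda>x. \<exists>K\<ge>0. \<forall>u. (cmod (cinner u x))\<^sup>2 \<le> K * ?q u"
  have q0: "0 \<le> ?q u" for u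
    by (intro sum_nonneg psd_nonneg B)
  have "vec.subspace {x. ?G x}"
    unfolding vec.subspace_def
  proof (intro conjI ballI allI)
    show "0 \<in> {x. ?G x}" by auto
  next
    fix x y assume "x \<in> {x. ?G x}" "y \<in> {x. ?G x}"
    then obtain K L where KL: "K \<ge> 0" "L \<ge> 0"
      "\<And>u. (cmod (cinner u x))\<^sup>2 \<le> K * ?q u" "\<And>u. (cmod (cinner u y))\<^sup>2 \<le> L * ?q u"
      by blast
    have "(cmod (cinner u (x + y)))\<^sup>2 \<le> (2 * K + 2 * L) * ?q u" for u
    proof -
      have "(cmod (cinner u (x + y)))\<^sup>2 \<le> (cmod (cinner u x) + cmod (cinner u y))\<^sup>2"
        by (intro power_mono) (simp_all add: cinner_simps norm_triangle_ineq)
      also have "\<dots> \<le> 2 * (cmod (cinner u x))\<^sup>2 + 2 * (cmod (cinner u y))\<^sup>2"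
        using zero_le_power2[of "cmod (cinner u x) - cmod (cinner u y)"]
        by (simp add: power2_sum power2_diff)
      also have "\<dots> \<le> 2 * (K * ?q u) + 2 * (L * ?q u)"
        using KL(3,4)[of u] by linarith
      finally show ?thesis by (simp add: distrib_right)
    qed
    then show "x + y \<in> {x. ?G x}"
      using KL(1,2) by (intro CollectI exI[of _ "2 * K + 2 * L"]) auto
  next
    fix c x assume "x \<in> {x. ?G x}"
    then obtain K where K: "K \<ge> 0" "\<And>u. (cmod (cinner u x))\<^sup>2 \<le> K * ?q u"
      by blast
    have "(cmod (cinner u (c *s x)))\<^sup>2 \<le> ((cmod c)\<^sup>2 * K) * ?q u" for u
      using mult_left_mono[OF K(2)[of u], of "(cmod c)\<^sup>2"]
      by (simp add: cinner_simps norm_mult power_mult_distrib mult.assoc)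
    then show "c *s x \<in> {x. ?G x}"
      using K(1) by (intro CollectI exI[of _ "(cmod c)\<^sup>2 * K"]) auto
  qed
  moreover have "(\<Union>j\<in>{1..i}. mat_range (B j)) \<subseteq> {x. ?G x}"
  proof (intro UN_least subsetI CollectI)
    fix j x assume j: "j \<in> {1..i}" and "x \<in> mat_range (B j)"
    then obtain y where y: "x = B j *v y" by (auto simp: mat_range_def)
    let ?K = "Re (cinner y (B j *v y)) + 1"
    have K: "0 \<le> ?K" using psd_nonneg[OF B[OF j], of y] by simp
    have "(cmod (cinner u x))\<^sup>2 \<le> ?K * ?q u" for u
    proof -
      have "(cmod (cinner u x))\<^sup>2 \<le> ?K * Re (cinner u (B j *v u))"
        unfolding y by (rule psd_cauchy_schwarz[OF B[OF j]])
      also have "\<dots> \<le> ?K * ?q u"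
        using K j by (intro mult_left_mono member_le_sum psd_nonneg B) auto
      finally show ?thesis .
    qed
    with K show "?G x" by blast
  qed
  ultimately have "ranges_span B i \<subseteq> {x. ?G x}"
    unfolding ranges_span_def by (intro vec.span_minimal)
  with x show ?thesis by blast
qed

section \<open>The limit of roots of weighted sums\<close>

lemma Re_cinner_weighted_sum:
  "Re (cinner x ((\<Sum>j\<in>J. complex_of_real (c j) *\<^sub>m B j) *v x)) =
    (\<Sum>j\<in>J. c j * Re (cinner x (B j *v x)))"
  by (simp add: sum_mscale_mult_vec cinner_sum_right cinner_simps Re_sum)

text \<open>
  Being orthogonal to the earlier ranges, \<open>x\<close> is annihilated by \<open>B\<^sub>j\<close> for \<open>j < i\<close>, so only weights at
  most \<open>a\<^sub>i\<^sup>p\<close> contribute to the form at \<open>x\<close>: this is the upper bound needed in \<open>mpowr_near_scalar\<close>.  The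
  lower bound comes from \<open>x\<close> lying in the span of the first \<open>i\<close> ranges, whose weights are at least
  \<open>a\<^sub>i\<^sup>p\<close>.
\<close>
lemma mpowr_weighted_sum_tendsto_on_layer:
  fixes B :: "nat \<Rightarrow> complex^'m^'m"
  assumes B: "\<And>j. j \<in> {1..n} \<Longrightarrow> psd (B j)"
    and nonneg: "\<And>j. j \<in> {1..n} \<Longrightarrow> 0 \<le> a j"
    and anti: "\<And>i j. 1 \<le> i \<Longrightarrow> i \<le> j \<Longrightarrow> j \<le> n \<Longrightarrow> a j \<le> a i"
    and i: "i \<in> {1..n}" and x: "x \<in> ranges_span B i \<ominus> ranges_span B (i - 1)"
  shows "((\<lambda>p. mpowr (\<Sum>j=1..n. complex_of_real (a j powr p) *\<^sub>m B j) (1 / p) *v x)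
           \<longlongrightarrow> complex_of_real (a i) *s x) at_top"
proof -
  let ?S = "\<lambda>p. \<Sum>j=1..n. complex_of_real (a j powr p) *\<^sub>m B j"
  let ?q = "\<lambda>j u. Re (cinner u (B j *v u))"
  have q0: "0 \<le> ?q j u" if "j \<in> {1..n}" for j u
    using that B psd_nonneg by blast
  have S: "psd (?S p)" for p
    by (intro psd_sum psd_mscale B) auto
  obtain K where K: "K \<ge> 0" "\<And>u. (cmod (cinner u x))\<^sup>2 \<le> K * (\<Sum>j=1..i. ?q j u)"
    using ranges_span_functional_bound[of i B x] x i B by (auto simp: ominus_def)
  \<comment> \<open>One constant, independent of \<open>p\<close>, for the three places where \<open>mpowr_near_scalar\<close> needs one.\<close>
  define C where "C = (norm x)\<^sup>2 + (\<Sum>j=1..n. ?q j x) + K"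
  have sum0: "0 \<le> (\<Sum>j=1..n. ?q j x)"
    by (intro sum_nonneg q0)
  have kill: "B j *v x = 0" if "j \<in> {1..n}" "j < i" for j
  proof (rule psd_kernel_of_range_orthogonal)
    show "psd (B j)" using that B by blast
    fix w assume "w \<in> mat_range (B j)"
    moreover have "j \<in> {1..i - 1}" using that by auto
    ultimately have "w \<in> ranges_span B (i - 1)"
      using mat_range_subset_ranges_span by blast
    then show "cinner w x = 0" using x by (simp add: ominus_def)
  qed
  have bound: "norm (mpowr (?S p) (1 / p) *v x - complex_of_real (a i) *s x) \<le>
      DIM(complex^'m) * (4 * a i * sqrt C) / p" if p: "4 \<le> p" for p
  proof -
    have "norm (mpowr (?S p) (1 / p) *v x - complex_of_real (a i) *s x) \<le>
      DIM(complex^'m) * (4 * a i * sqrt C / p)"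
    proof (rule mpowr_near_scalar[OF S p])
      show "0 \<le> a i" using nonneg i .
      show "(norm x)\<^sup>2 \<le> C" using sum0 K by (simp add: C_def)
      have "Re (cinner x (?S p *v x)) = (\<Sum>j=1..n. a j powr p * ?q j x)"
        by (rule Re_cinner_weighted_sum)
      also have "\<dots> \<le> (\<Sum>j=1..n. a i powr p * ?q j x)"
      proof (rule sum_mono)
        fix j assume j: "j \<in> {1..n}"
        show "a j powr p * ?q j x \<le> a i powr p * ?q j x"
        proof (cases "j < i")
          case True
          then show ?thesis using kill[OF j] by simp
        next
          case False
          then have "a j powr p \<le> a i powr p"
            using anti i j nonneg p by (intro powr_mono2) auto
          then show ?thesis using q0[OF j] by (rule mult_right_mono)
        qed
      qed
      also have "\<dots> = (\<Sum>j=1..n. ?q j x) * a i powr p"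
        by (simp add: sum_distrib_left mult.commute)
      also have "\<dots> \<le> C * a i powr p"
        using K by (intro mult_right_mono) (auto simp: C_def)
      finally show "Re (cinner x (?S p *v x)) \<le> C * a i powr p" .
      fix u
      have "a i powr p * (cmod (cinner u x))\<^sup>2 \<le> a i powr p * (K * (\<Sum>j=1..i. ?q j u))"
        using K by (intro mult_left_mono) auto
      also have "\<dots> = K * (\<Sum>j=1..i. a i powr p * ?q j u)"
        by (simp add: sum_distrib_left mult_ac)
      also have "\<dots> \<le> K * (\<Sum>j=1..i. a j powr p * ?q j u)"
        using K i anti nonneg p by (intro mult_left_mono sum_mono mult_right_mono powr_mono2 q0) auto
      also have "\<dots> \<le> K * (\<Sum>j=1..n. a j powr p * ?q j u)"
        using K i by (intro mult_left_mono sum_mono2 mult_nonneg_nonneg q0) auto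
      also have "\<dots> \<le> C * (\<Sum>j=1..n. a j powr p * ?q j u)"
        using sum0 by (intro mult_right_mono sum_nonneg mult_nonneg_nonneg q0) (auto simp: C_def)
      finally show "a i powr p * (cmod (cinner u x))\<^sup>2 \<le> C * Re (cinner u (?S p *v u))"
        by (simp only: Re_cinner_weighted_sum)
    qed
    then show ?thesis by simp
  qed
  have "((\<lambda>p. mpowr (?S p) (1 / p) *v x - complex_of_real (a i) *s x) \<longlongrightarrow> 0) at_top"
  proof (rule Lim_null_comparison)
    show "\<forall>\<^sub>F p in at_top. norm (mpowr (?S p) (1 / p) *v x - complex_of_real (a i) *s x) \<le>
        DIM(complex^'m) * (4 * a i * sqrt C) / p"
      using eventually_ge_at_top[of 4] by eventually_elim (rule bound)
    show "((\<lambda>p. DIM(complex^'m) * (4 * a i * sqrt C) / p) \<longlongrightarrow> 0) at_top"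
      by (intro tendsto_divide_0[OF tendsto_const] filterlim_at_top_imp_at_infinity filterlim_ident)
  qed
  then show ?thesis by (rule LIM_zero_cancel)
qed

lemma tendsto_vec_scale:
  "(f \<longlongrightarrow> l) F \<Longrightarrow> ((\<lambda>p. c *s (f p :: complex^'n)) \<longlongrightarrow> c *s l) F"
  by (intro vec_tendstoI) (simp add: tendsto_mult_left tendsto_vec_nth)

lemma matrix_tendsto_pointwise:
  fixes X :: "'b \<Rightarrow> complex^'n^'m"
  assumes "\<And>x. ((\<lambda>p. X p *v x) \<longlongrightarrow> L *v x) F"
  shows "(X \<longlongrightarrow> L) F"
proof (intro vec_tendstoI)
  fix i j
  have "((\<lambda>p. (X p *v axis j 1) $ i) \<longlongrightarrow> (L *v axis j 1) $ i) F"
    by (intro tendsto_vec_nth assms)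
  then show "((\<lambda>p. X p $ i $ j) \<longlongrightarrow> L $ i $ j) F"
    by (simp add: matrix_vector_mult_def axis_def if_distrib[where f = "\<lambda>c. _ * c"] cong: if_cong)
qed

text \<open>
  The vectors on which the roots converge to the right limit form a subspace \<open>L\<close>.  It contains every
  layer by the previous lemma, hence all spans of ranges, because each span is the previous one plus a
  layer; and it contains the orthogonal complement of the last span, where every \<open>B\<^sub>j\<close> vanishes.
\<close>
theorem mpowr_weighted_sum_tendsto:
  fixes B :: "nat \<Rightarrow> complex^'m^'m"
  assumes B: "\<And>j. j \<in> {1..n} \<Longrightarrow> psd (B j)"
    and nonneg: "\<And>j. j \<in> {1..n} \<Longrightarrow> 0 \<le> a j"
    and anti: "\<And>i j. 1 \<le> i \<Longrightarrow> i \<le> j \<Longrightarrow> j \<le> n \<Longrightarrow> a j \<le> a i"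
  shows "((\<lambda>p. mpowr (\<Sum>j=1..n. complex_of_real (a j powr p) *\<^sub>m B j) (1 / p)) \<longlongrightarrow>
      (\<Sum>i=1..n. complex_of_real (a i) *\<^sub>m orth_proj (ranges_span B i \<ominus> ranges_span B (i - 1))))
      at_top"
proof -
  let ?S = "\<lambda>p. \<Sum>j=1..n. complex_of_real (a j powr p) *\<^sub>m B j"
  let ?R = "ranges_span B"
  let ?M = "\<lambda>i. ?R i \<ominus> ?R (i - 1)"
  define D where "D = (\<Sum>i=1..n. complex_of_real (a i) *\<^sub>m orth_proj (?M i))"
  define L where "L = {x. ((\<lambda>p. mpowr (?S p) (1 / p) *v x) \<longlongrightarrow> D *v x) at_top}"
  have M: "vec.subspace (?M i)" for i
    by (intro subspace_ominus subspace_ranges_span)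
  have L: "vec.subspace L"
    unfolding vec.subspace_def L_def mem_Collect_eq matrix_vector_right_distrib vector_scalar_commute
    by (intro conjI ballI allI impI tendsto_add tendsto_vec_scale) simp_all
  have D_eq: "D *v x = (\<Sum>i=1..n. complex_of_real (a i) *s (orth_proj (?M i) *v x))" for x
    unfolding D_def by (rule sum_mscale_mult_vec)
  have M_L: "x \<in> L" if k: "k \<in> {1..n}" and x: "x \<in> ?M k" for k x
  proof -
    have "orth_proj (?M j) *v x = (if j = k then x else 0)" if j: "j \<in> {1..n}" for j
    proof (cases j k rule: linorder_cases)
      case less
      then have "?R j \<subseteq> ?R (k - 1)" by (intro ranges_span_mono) auto
      then have "orth_proj (?M j) *v x = 0"
        using x by (intro orth_proj_kills[OF M]) (auto simp: ominus_def)
      with less show ?thesis by simp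
    next
      case equal
      with orth_proj_fixes[OF M x] show ?thesis by simp
    next
      case greater
      then have "?R k \<subseteq> ?R (j - 1)" by (intro ranges_span_mono) auto
      then have "orth_proj (?M j) *v x = 0"
        using x by (intro orth_proj_kills[OF M])
          (auto simp: ominus_def cinner_eq_0_commute[of _ x])
      with greater show ?thesis by simp
    qed
    then have "D *v x = (\<Sum>i=1..n. if i = k then complex_of_real (a i) *s x else 0)"
      unfolding D_eq by (intro sum.cong) auto
    then have "D *v x = complex_of_real (a k) *s x"
      using k by simp
    then show ?thesis
      unfolding L_def
      using mpowr_weighted_sum_tendsto_on_layer[of n B a k x, OF B nonneg anti k x] by simp
  qed
  have R_L: "?R k \<subseteq> L" if "k \<le> n" for k
    using that
  proof (induction k)
    case 0
    then show ?case using L by (simp add: ranges_span_0 vec.subspace_0)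
  next
    case (Suc k)
    show ?case
    proof
      fix x assume x: "x \<in> ?R (Suc k)"
      obtain y z where yz: "x = y + z" "y \<in> ?R k" "\<forall>w\<in>?R k. cinner w z = 0"
        using orthogonal_decomposition[OF subspace_ranges_span[of B k], of x] by blast
      have "y \<in> ?R (Suc k)" using yz(2) ranges_span_mono[of k "Suc k"] by auto
      then have "x - y \<in> ?R (Suc k)"
        using x by (intro vec.subspace_diff subspace_ranges_span)
      then have "z \<in> ?M (Suc k)" using yz by (simp add: ominus_def)
      then have "z \<in> L" using Suc.prems by (intro M_L[of "Suc k"]) auto
      moreover have "y \<in> L" using Suc.IH Suc.prems yz(2) by auto
      ultimately show "x \<in> L" unfolding yz(1) by (intro vec.subspace_add[OF L])
    qed
  qed
  have perp_L: "z \<in> L" if z: "\<And>w. w \<in> ?R n \<Longrightarrow> cinner w z = 0" for z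
  proof -
    have "B j *v z = 0" if j: "j \<in> {1..n}" for j
      using mat_range_subset_ranges_span[OF j] z
      by (intro psd_kernel_of_range_orthogonal B[OF j]) blast
    then have "?S p *v z = 0" for p
      unfolding sum_mscale_mult_vec by (intro sum.neutral) auto
    then have "?S p *v z = complex_of_real 0 *s z" for p
      by simp
    moreover have "psd (?S p)" for p
      by (intro psd_sum psd_mscale B) auto
    ultimately have "mpowr (?S p) (1 / p) *v z = complex_of_real (0 powr (1 / p)) *s z" for p
      unfolding mpowr_def by (intro fun_calc_eigenvector psd_hermitian)
    then have "mpowr (?S p) (1 / p) *v z = 0" for p
      by simp
    moreover have "orth_proj (?M i) *v z = 0" if "i \<in> {1..n}" for i
    proof -
      have "?R i \<subseteq> ?R n" using that by (intro ranges_span_mono) auto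
      then show ?thesis
        using z by (intro orth_proj_kills[OF M]) (auto simp: ominus_def)
    qed
    then have "D *v z = 0"
      unfolding D_eq by (intro sum.neutral) auto
    ultimately show ?thesis by (simp add: L_def)
  qed
  have "x \<in> L" for x
  proof -
    obtain y z where yz: "x = y + z" "y \<in> ?R n" "\<forall>w\<in>?R n. cinner w z = 0"
      using orthogonal_decomposition[OF subspace_ranges_span[of B n], of x] by blast
    then have "y \<in> L" "z \<in> L"
      using R_L[of n] perp_L[of z] by auto
    then show ?thesis unfolding yz(1) by (rule vec.subspace_add[OF L])
  qed
  then show ?thesis
    unfolding D_def[symmetric] L_def by (intro matrix_tendsto_pointwise) simp
qed

section \<open>Positive linear maps\<close>

lemma subspace_mat_range: "vec.subspace (mat_range X)"
proof -
  have "mat_range X = (*v) X ` UNIV" by (simp add: mat_range_def)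
  then show ?thesis
    using vec.linear_subspace_image[OF matrix_vector_mul_linear_gen vec.subspace_UNIV] by metis
qed

text \<open>
  The first space is no exception: its predecessor in the chain is the span of no ranges, which is
  the zero space.
\<close>
lemma M_space_eq:
  fixes \<Phi> :: "complex^'n^'n \<Rightarrow> complex^'m^'m" and v :: "nat \<Rightarrow> complex^'n"
  assumes "1 \<le> i"
  defines "B \<equiv> \<lambda>j. \<Phi> (ketbra (v j) (v j))"
  shows "M_space \<Phi> v i = ranges_span B i \<ominus> ranges_span B (i - 1)"
proof (cases "i = 1")
  case True
  have "ranges_span B 1 = mat_range (B 1)"
    by (simp add: ranges_span_def vec.span_eq_iff[THEN iffD2, OF subspace_mat_range])
  moreover have "ranges_span B 1 \<ominus> {0} = ranges_span B 1"
    by (simp add: ominus_def)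
  ultimately show ?thesis
    using True by (simp add: M_space_def ranges_span_0 B_def)
next
  case False
  then show ?thesis by (simp add: M_space_def ran_join_def ranges_span_def B_def)
qed

lemma mpowr_orthonormal_diagonal:
  fixes A :: "complex^'n^'n"
  assumes A: "cadjoint A = A" and v: "orthonormal_basis n v"
    and A_eq: "A = (\<Sum>i=1..n. complex_of_real (a i) *\<^sub>m ketbra (v i) (v i))"
  shows "mpowr A p = (\<Sum>i=1..n. complex_of_real (a i powr p) *\<^sub>m ketbra (v i) (v i))"
    and "i \<in> {1..n} \<Longrightarrow> A *v v i = complex_of_real (a i) *s v i"
proof -
  have diag: "(\<Sum>i=1..n. complex_of_real (c i) *\<^sub>m ketbra (v i) (v i)) *v v k =
      complex_of_real (c k) *s v k" if k: "k \<in> {1..n}" for c k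
  proof -
    have "(\<Sum>i=1..n. complex_of_real (c i) *\<^sub>m ketbra (v i) (v i)) *v v k =
        (\<Sum>i=1..n. if i = k then complex_of_real (c i) *s v i else 0)"
      unfolding sum_mscale_mult_vec
      using v k by (intro sum.cong) (auto simp: ketbra_mult_vec orthonormal_basis_def)
    then show ?thesis using k by simp
  qed
  show ev: "A *v v i = complex_of_real (a i) *s v i" if "i \<in> {1..n}" for i
    unfolding A_eq using that by (rule diag)
  let ?N = "\<Sum>i=1..n. complex_of_real (a i powr p) *\<^sub>m ketbra (v i) (v i)"
  have "mpowr A p *v v k = ?N *v v k" if "k \<in> {1..n}" for k
    unfolding diag[OF that] mpowr_def using ev[OF that] by (rule fun_calc_eigenvector[OF A])
  moreover have "vec.subspace {x. mpowr A p *v x = ?N *v x}"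
    by (simp add: vec.subspace_def matrix_vector_right_distrib vector_scalar_commute)
  ultimately have "vec.span (v ` {1..n}) \<subseteq> {x. mpowr A p *v x = ?N *v x}"
    by (intro vec.span_minimal) auto
  then show "mpowr A p = ?N"
    using v by (auto simp: matrix_eq orthonormal_basis_def)
qed

lemma positive_linear_map_weighted_sum:
  assumes "positive_linear_map \<Phi>"
  shows "\<Phi> (\<Sum>i\<in>I. c i *\<^sub>m X i) = (\<Sum>i\<in>I. c i *\<^sub>m \<Phi> (X i))"
proof -
  interpret Vector_Spaces.linear "(*\<^sub>m)" "(*\<^sub>m)" \<Phi>
    using assms by (simp add: positive_linear_map_def)
  show ?thesis by (simp add: sum scale)
qed

theorem theorem2p4:
  fixes \<Phi> :: "complex^'n^'n \<Rightarrow> complex^'m^'m"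
    and A :: "complex^'n^'n"
    and a :: "nat \<Rightarrow> real"
    and v :: "nat \<Rightarrow> complex^'n"
  assumes "positive_linear_map \<Phi>"
    and "psd A"
    and "orthonormal_basis CARD('n) v"
    and "\<forall>i\<in>{1..CARD('n)}. \<forall>j\<in>{1..CARD('n)}. i \<le> j \<longrightarrow> a j \<le> a i"
    and "A = (\<Sum>i=1..CARD('n). complex_of_real (a i) *\<^sub>m ketbra (v i) (v i))"
  shows "((\<lambda>p::real. mpowr (\<Phi> (mpowr A p)) (1 / p)) \<longlongrightarrow>
           (\<Sum>i=1..CARD('n). complex_of_real (a i) *\<^sub>m orth_proj (M_space \<Phi> v i))) at_top"
proof -
  let ?B = "\<lambda>j. \<Phi> (ketbra (v j) (v j))"
  note diag = mpowr_orthonormal_diagonal[OF psd_hermitian[OF assms(2)] assms(3,5)]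
  have nonneg: "0 \<le> a i" if i: "i \<in> {1..CARD('n)}" for i
  proof (rule psd_eigenvalue_nonneg[OF assms(2)])
    have "cinner (v i) (v i) = 1"
      using assms(3) i by (simp add: orthonormal_basis_def)
    then have "v i \<noteq> 0" by auto
    then show "a i \<in> real_eigenvalues A"
      using diag(2)[OF i] by (auto simp: real_eigenvalues_def)
  qed
  have "psd (?B j)" for j
    using assms(1) psd_ketbra by (auto simp: positive_linear_map_def)
  then have "((\<lambda>p. mpowr (\<Sum>j=1..CARD('n). complex_of_real (a j powr p) *\<^sub>m ?B j) (1 / p)) \<longlongrightarrow>
      (\<Sum>i=1..CARD('n). complex_of_real (a i) *\<^sub>m
        orth_proj (ranges_span ?B i \<ominus> ranges_span ?B (i - 1)))) at_top"
    using nonneg assms(4) by (intro mpowr_weighted_sum_tendsto) auto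
  moreover have "\<Phi> (mpowr A p) = (\<Sum>j=1..CARD('n). complex_of_real (a j powr p) *\<^sub>m ?B j)" for p
    by (simp only: diag(1) positive_linear_map_weighted_sum[OF assms(1)])
  moreover have "(\<Sum>i=1..CARD('n). complex_of_real (a i) *\<^sub>m orth_proj (M_space \<Phi> v i)) =
      (\<Sum>i=1..CARD('n). complex_of_real (a i) *\<^sub>m
        orth_proj (ranges_span ?B i \<ominus> ranges_span ?B (i - 1)))"
    by (intro sum.cong) (simp_all add: M_space_eq)
  ultimately show ?thesis by simp
qed

end
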